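(* Let $n,d\ge 1$ be integers. For $i=1,\dots,n$ let $F_i=g_i-h_i$ with $g_i:\mathbb{R}^d\to\mathbb{R}\cup\{+\infty\}$ lower semicontinuous proper convex and $h_i:\mathbb{R}^d\to\mathbb{R}$ convex. Let $G=\frac1n\sum_{i=1}^n g_i$ (assumed proper), $H=\frac1n\sum_{i=1}^n h_i$ and $F=\frac1n\sum_{i=1}^n F_i=G-H$. Assume that $\alpha^*=\inf_{x\in\mathbb{R}^d}F(x)>-\infty$. Let $\{x^l\}$ be a sequence generated by the ISDCA algorithm (described in the context), with $|s_l|=b$ for all $l>0$, where $b\in\{1,\dots,n\}$ is fixed, with respect to a nonnegative sequence $\{\epsilon^l\}$ such that $\sum_{l=0}^\infty\epsilon^l<+\infty$ almost surely. Then the following statements hold. (a) The sequence $\{F(x^l)\}$ converges almost surely. (b) If $\min_{i}\rho(h_i)>0$, then almost surely $\sum_{l=1}^{\infty}\|x^l-x^{l-1}\|^2<+\infty$ and $\lim_{l\to\infty}\|x^l-x^{l-1}\|=0$. (c) If $\min_{i}\rho(h_i)>0$, then, with probability one, every limit point of $\{x^l\}$ is a critical point of $F$.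
   Context: Norms and inner products are Euclidean. For a convex function $\theta:\mathbb{R}^d\to\mathbb{R}\cup\{+\infty\}$, the modulus of convexity is $\rho(\theta)=\sup\{\rho\ge 0:\ \theta-\frac{\rho}{2}\|\cdot\|^2\text{ is convex on }\mathbb{R}^d\}$. For $\epsilon\ge0$ and $x^0\in\operatorname{dom}\theta$, the $\epsilon$-subdifferential is $\partial_\epsilon\theta(x^0)=\{y\in\mathbb{R}^d:\ \theta(x)\ge\theta(x^0)+\langle x-x^0,y\rangle-\epsilon\ \ \forall x\in\mathbb{R}^d\}$; for $\epsilon=0$ this is the usual subdifferential $\partial\theta(x^0)$. For $\epsilon\ge0$, a point $x_\epsilon$ is an $\epsilon$-solution of $\inf\{f(x):x\in\mathbb{R}^d\}$ if $f(x_\epsilon)\le f(x)+\epsilon$ for all $x\in\mathbb{R}^d$. A point $x^*$ is a critical point of $F=G-H$ (with respect to this decomposition) if $\partial G(x^* )\cap\partial H(x^* )\neq\emptyset$. ISDCA algorithm (inexact stochastic DCA) for minimizing $F$ over $\mathbb{R}^d$. Initialization: choose a (deterministic) point $x^0\in\mathbb{R}^d$, $\epsilon^0\ge0$, and set $s_0=\{1,\dots,n\}$. For $l=0,1,2,\dots$ (run indefinitely): 1. For $i\in s_l$ choose $v_i^l\in\partial_{\epsilon^l}h_i(x^l)$; for $i\notin s_l$ (which can only occur when $l>0$) set $v_i^l=v_i^{l-1}$. Set $v^l=\frac1n\sum_{i=1}^n v_i^l$. 2. Let $x^{l+1}$ be an $\epsilon^l$-solution of the convex problem $\min\{G(x)-\langle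 v^l,x\rangle:\ x\in\mathbb{R}^d\}$ (a sequence generated by ISDCA is one for which such points exist and are selected at each iteration). 3. Choose randomly a subset $s_{l+1}\subset\{1,\dots,n\}$ and choose $\epsilon^{l+1}\ge0$ (possibly random) for the next iteration. For $l\ge1$, the random choice means that, conditionally on the entire history of the algorithm (all $x^0,\dots,x^l$, $\epsilon^0,\dots,\epsilon^l$, $s_0,\dots,s_{l-1}$, and all $v_i^k$ with $k\le l-1$), $s_l$ is uniformly distributed over the subsets of $\{1,\dots,n\}$ of cardinality $b$. All iterates $x^l$, tolerances $\epsilon^l$ and chosen vectors $v_i^l$ are random variables (measurable). "Almost surely" and "with probability one" refer to the randomness of the subsets and selections. *)

theory Defs
  imports "HOL-Probability.Probability"
begin

section \<open>Extended-real-valued convex functions\<close>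

text \<open>
  Functions with values in the reals extended by \<open>+\<infinity>\<close> are modelled as \<^typ>\<open>ereal\<close>-valued
  functions that avoid \<open>-\<infinity>\<close>. In \<^term>\<open>ext_convex\<close> the convention \<open>0 * \<infinity> = 0\<close> makes the
  boundary weights harmless.
\<close>

definition ext_convex :: "('a::real_vector \<Rightarrow> ereal) \<Rightarrow> bool" where
  "ext_convex \<theta> \<longleftrightarrow> (\<forall>x. \<theta> x \<noteq> -\<infinity>) \<and>
     (\<forall>x y. \<forall>u\<ge>0. \<forall>v\<ge>0. u + v = 1 \<longrightarrow>
        \<theta> (u *\<^sub>R x + v *\<^sub>R y) \<le> ereal u * \<theta> x + ereal v * \<theta> y)"

definition proper_fun :: "('a \<Rightarrow> ereal) \<Rightarrow> bool" where
  "proper_fun \<theta> \<longleftrightarrow> (\<forall>x. \<theta> x \<noteq> -\<infinity>) \<and> (\<exists>x. \<theta> x < \<infinity>)"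

definition lsc_fun :: "('a::topological_space \<Rightarrow> ereal) \<Rightarrow> bool" where
  "lsc_fun \<theta> \<longleftrightarrow> (\<forall>x. \<theta> x \<le> Liminf (at x) \<theta>)"

definition convexity_modulus :: "('a::real_normed_vector \<Rightarrow> ereal) \<Rightarrow> ereal" where
  "convexity_modulus \<theta> =
     Sup {ereal \<rho> | \<rho>. \<rho> \<ge> 0 \<and> ext_convex (\<lambda>x. \<theta> x - ereal (\<rho> / 2 * (norm x)\<^sup>2))}"

text \<open>The \<open>\<epsilon>\<close>-subdifferential is empty outside the effective domain.\<close>

definition eps_subdiff :: "real \<Rightarrow> ('a::real_inner \<Rightarrow> ereal) \<Rightarrow> 'a \<Rightarrow> 'a set" where
  "eps_subdiff \<epsilon> \<theta> x0 =
     {y. \<theta> x0 < \<infinity> \<and> (\<forall>x. \<theta> x \<ge> \<theta> x0 + ereal (inner (x - x0) y) - ereal \<epsilon>)}"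

abbreviation subdiff :: "('a::real_inner \<Rightarrow> ereal) \<Rightarrow> 'a \<Rightarrow> 'a set" where
  "subdiff \<equiv> eps_subdiff 0"

definition eps_solution :: "real \<Rightarrow> ('a \<Rightarrow> ereal) \<Rightarrow> 'a \<Rightarrow> bool" where
  "eps_solution \<epsilon> f z \<longleftrightarrow> (\<forall>x. f z \<le> f x + ereal \<epsilon>)"

definition critical_point :: "('a::real_inner \<Rightarrow> ereal) \<Rightarrow> ('a \<Rightarrow> real) \<Rightarrow> 'a \<Rightarrow> bool" where
  "critical_point G H z \<longleftrightarrow> subdiff G z \<inter> subdiff (\<lambda>x. ereal (H x)) z \<noteq> {}"

definition seq_limit_point :: "(nat \<Rightarrow> 'a::topological_space) \<Rightarrow> 'a \<Rightarrow> bool" where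
  "seq_limit_point X z \<longleftrightarrow> (\<exists>r::nat \<Rightarrow> nat. strict_mono r \<and> (X \<circ> r) \<longlonglongrightarrow> z)"

lemma ext_convex_ereal_iff: "ext_convex (\<lambda>x. ereal (f x)) \<longleftrightarrow> convex_on UNIV f"
  by (simp add: ext_convex_def convex_on_def)

lemma mean_diff_ereal:
  fixes a :: "nat \<Rightarrow> ereal" and c :: "nat \<Rightarrow> real"
  assumes "\<And>i. i \<in> {1..n} \<Longrightarrow> a i \<noteq> -\<infinity>" and "n \<ge> 1"
  shows "ereal (1 / real n) * (\<Sum>i=1..n. a i - ereal (c i)) =
         ereal (1 / real n) * (\<Sum>i=1..n. a i) - ereal ((1 / real n) * (\<Sum>i=1..n. c i))"
proof (cases "\<exists>i\<in>{1..n}. a i = \<infinity>")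
  case True
  then have "(\<Sum>i=1..n. a i) = \<infinity>" "(\<Sum>i=1..n. a i - ereal (c i)) = \<infinity>"
    by (force simp: sum_Pinfty)+
  with \<open>n \<ge> 1\<close> show ?thesis by simp
next
  case False
  define r where "r i = real_of_ereal (a i)" for i
  have "a i = ereal (r i)" if "i \<in> {1..n}" for i
    using that False assms(1)[of i] by (cases "a i") (auto simp: r_def)
  then have "(\<Sum>i=1..n. a i) = ereal (\<Sum>i=1..n. r i)"
    "(\<Sum>i=1..n. a i - ereal (c i)) = ereal (\<Sum>i=1..n. r i - c i)"
    by (auto simp flip: sum_ereal intro!: sum.cong)
  then show ?thesis
    by (simp add: sum_subtractf right_diff_distrib diff_divide_distrib)
qed

section \<open>Inexact stochastic DCA\<close>

text \<open>
  Arguments of type \<open>nat\<close> are, in order, the iteration \<open>l\<close> and (for \<open>v\<close>) the component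
  \<open>i \<in> {1..n}\<close>; the last argument is the random outcome.
  The history is the information on which the choice of \<open>s l\<close> is conditioned: it contains
  \<open>x k\<close> and \<open>\<epsilon> k\<close> for \<open>k \<le> l\<close>, but \<open>s k\<close> and \<open>v k i\<close> only for \<open>k < l\<close>.
\<close>

definition preimages :: "'w measure \<Rightarrow> 'b measure \<Rightarrow> ('w \<Rightarrow> 'b) \<Rightarrow> 'w set set" where
  "preimages M N f = {f -` A \<inter> space M | A. A \<in> sets N}"

definition isdca_history ::
  "'w measure \<Rightarrow> nat \<Rightarrow> (nat \<Rightarrow> 'w \<Rightarrow> 'a::euclidean_space) \<Rightarrow> (nat \<Rightarrow> 'w \<Rightarrow> real) \<Rightarrow>
   (nat \<Rightarrow> 'w \<Rightarrow> nat set) \<Rightarrow> (nat \<Rightarrow> nat \<Rightarrow> 'w \<Rightarrow> 'a) \<Rightarrow> nat \<Rightarrow> 'w measure" where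
  "isdca_history M n x \<epsilon> s v l = sigma (space M)
     ((\<Union>k\<le>l. preimages M borel (x k)) \<union>
      (\<Union>k\<le>l. preimages M borel (\<epsilon> k)) \<union>
      (\<Union>k<l. preimages M (count_space (Pow {1..n})) (s k)) \<union>
      (\<Union>k<l. \<Union>i\<in>{1..n}. preimages M borel (v k i)))"

text \<open>The conditional distribution of \<open>S\<close> given \<open>\<F>\<close> is uniform on the \<open>b\<close>-element subsets of \<open>{1..n}\<close>.\<close>

definition cond_uniform_subset ::
  "'w measure \<Rightarrow> 'w measure \<Rightarrow> nat \<Rightarrow> nat \<Rightarrow> ('w \<Rightarrow> nat set) \<Rightarrow> bool" where
  "cond_uniform_subset M \<F> n b S \<longleftrightarrow>
     (\<forall>A. A \<subseteq> {1..n} \<and> card A = b \<longrightarrow>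
        (AE \<omega> in M. real_cond_exp M \<F> (indicator {\<omega> \<in> space M. S \<omega> = A}) \<omega> = 1 / real (n choose b)))"

definition isdca_run ::
  "'w measure \<Rightarrow> nat \<Rightarrow> nat \<Rightarrow> ('a::euclidean_space \<Rightarrow> ereal) \<Rightarrow> (nat \<Rightarrow> 'a \<Rightarrow> real) \<Rightarrow>
   (nat \<Rightarrow> 'w \<Rightarrow> 'a) \<Rightarrow> (nat \<Rightarrow> 'w \<Rightarrow> real) \<Rightarrow> (nat \<Rightarrow> 'w \<Rightarrow> nat set) \<Rightarrow>
   (nat \<Rightarrow> nat \<Rightarrow> 'w \<Rightarrow> 'a) \<Rightarrow> bool" where
  "isdca_run M n b G h x \<epsilon> s v \<longleftrightarrow>
     (\<forall>l. x l \<in> borel_measurable M) \<and>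
     (\<forall>l. \<epsilon> l \<in> borel_measurable M) \<and>
     (\<forall>l. s l \<in> M \<rightarrow>\<^sub>M count_space (Pow {1..n})) \<and>
     (\<forall>l. \<forall>i\<in>{1..n}. v l i \<in> borel_measurable M) \<and>
     (\<exists>x0. \<forall>\<omega>\<in>space M. x 0 \<omega> = x0) \<and>
     (\<forall>l. \<forall>\<omega>\<in>space M. \<epsilon> l \<omega> \<ge> 0) \<and>
     (\<forall>\<omega>\<in>space M. s 0 \<omega> = {1..n}) \<and>
     (\<forall>l>0. \<forall>\<omega>\<in>space M. card (s l \<omega>) = b) \<and>
     (\<forall>l. \<forall>\<omega>\<in>space M. \<forall>i\<in>s l \<omega>.
        v l i \<omega> \<in> eps_subdiff (\<epsilon> l \<omega>) (\<lambda>y. ereal (h i y)) (x l \<omega>)) \<and>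
     (\<forall>l>0. \<forall>\<omega>\<in>space M. \<forall>i\<in>{1..n} - s l \<omega>. v l i \<omega> = v (l - 1) i \<omega>) \<and>
     (\<forall>l. \<forall>\<omega>\<in>space M.
        eps_solution (\<epsilon> l \<omega>)
          (\<lambda>y. G y - ereal (inner ((1 / real n) *\<^sub>R (\<Sum>i=1..n. v l i \<omega>)) y))
          (x (Suc l) \<omega>)) \<and>
     (\<forall>l>0. cond_uniform_subset M (isdca_history M n x \<epsilon> s v l) n b (s l))"

lemma preimages_subset_sets: "f \<in> M \<rightarrow>\<^sub>M N \<Longrightarrow> preimages M N f \<subseteq> sets M"
  by (auto simp: preimages_def)

lemma subalgebra_isdca_history:
  assumes "isdca_run M n b G h x \<epsilon> s v"
  shows "subalgebra M (isdca_history M n x \<epsilon> s v l)"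
proof -
  have m: "\<And>k. x k \<in> borel_measurable M" "\<And>k. \<epsilon> k \<in> borel_measurable M"
    "\<And>k. s k \<in> M \<rightarrow>\<^sub>M count_space (Pow {1..n})"
    "\<And>k i. i \<in> {1..n} \<Longrightarrow> v k i \<in> borel_measurable M"
    using assms by (auto simp: isdca_run_def)
  let ?E = "(\<Union>k\<le>l. preimages M borel (x k)) \<union> (\<Union>k\<le>l. preimages M borel (\<epsilon> k)) \<union>
      (\<Union>k<l. preimages M (count_space (Pow {1..n})) (s k)) \<union>
      (\<Union>k<l. \<Union>i\<in>{1..n}. preimages M borel (v k i))"
  have E: "?E \<subseteq> sets M"
    using m by (intro Un_least UN_least preimages_subset_sets) auto
  then have "?E \<subseteq> Pow (space M)"
    using sets.space_closed by blast
  with E show ?thesis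
    unfolding subalgebra_def isdca_history_def
    by (simp add: sets.sigma_sets_subset)
qed

end

theory Submission
  imports Defs
begin

text \<open>
  Each chosen vector \<open>v\<^sub>i\<close> comes with a cut, an affine function \<open>m\<^sub>i\<close> below \<open>h\<^sub>i\<close>, namely the one
  that the \<open>\<epsilon>\<close>-subgradient inequality provides at the iterate where \<open>v\<^sub>i\<close> was last refreshed. The
  tolerance of that iteration is subtracted in the cut itself, so \<open>m\<^sub>i\<^sup>l \<le> h\<^sub>i\<close> holds everywhere, even
  when the cut is old, and no tolerance ever has to be counted again while its cut remains in use.
  Write \<open>gap\<^sub>i\<^sup>l = h\<^sub>i(x\<^sup>l\<^sup>+\<^sup>1) - m\<^sub>i\<^sup>l(x\<^sup>l\<^sup>+\<^sup>1) \<ge> 0\<close> and let \<open>Z\<^sub>l\<close> be the value at \<open>x\<^sup>l\<^sup>+\<^sup>1\<close> of the convex model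
  of \<open>F\<close>, in which every \<open>h\<^sub>i\<close> is replaced by \<open>m\<^sub>i\<^sup>l\<close>. Then \<open>Z\<^sub>l\<close> is \<open>F(x\<^sup>l\<^sup>+\<^sup>1)\<close> plus the mean of the
  gaps, hence bounded below by \<open>\<alpha>\<^sup>*\<close>.

  Refreshing the cuts in \<open>s\<^sub>l\<^sub>+\<^sub>1\<close> lowers the model at \<open>x\<^sup>l\<^sup>+\<^sup>1\<close> by \<open>(gap\<^sub>i\<^sup>l - \<epsilon>\<^sup>l\<^sup>+\<^sup>1)/n\<close> for each refreshed \<open>i\<close>,
  and approximate minimization raises its value by at most \<open>\<epsilon>\<^sup>l\<^sup>+\<^sup>1\<close>. So on every trajectory
  with summable tolerances \<open>Z\<close> is a decreasing sequence up to a summable error: \<open>Z\<close> converges, and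
  for each \<open>i\<close> the gaps at the times \<open>l\<close> with \<open>i \<in> s\<^sub>l\<^sub>+\<^sub>1\<close> have a finite sum
  (\<open>model_value_and_sampled_gaps\<close>). This part involves no probability.

  Randomness enters once. The gap at \<open>l\<close> is determined by the history on which the choice of
  \<open>s\<^sub>l\<^sub>+\<^sub>1\<close> is conditioned, and a fixed \<open>b\<close>-element set containing \<open>i\<close> is chosen with constant positive
  conditional probability. A nonnegative series whose terms are observed at such times with a finite
  total has a finite total itself, almost surely (\<open>AE_summable_of_sampled\<close>, a form of the
  conditional Borel-Cantelli lemma). Hence almost surely all gaps are summable
  (\<open>isdca_gaps_summable\<close>), and the three statements follow on each such trajectory.
  For (a), \<open>F(x\<^sup>l\<^sup>+\<^sup>1)\<close> differs from the convergent \<open>Z\<^sub>l\<close> by the mean gap, which tends to \<open>0\<close>.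
  For (b), strong convexity makes the gap of a freshly cut component at least a multiple of
  \<open>\<parallel>x\<^sup>l\<^sup>+\<^sup>1 - x\<^sup>l\<parallel>\<^sup>2\<close>, up to \<open>\<epsilon>\<^sup>l\<close>.
  For (c), the mean \<open>v\<^sup>l\<close> is an \<open>\<epsilon>\<^sup>l\<close>-subgradient of \<open>G\<close> at \<open>x\<^sup>l\<^sup>+\<^sup>1\<close> because \<open>x\<^sup>l\<^sup>+\<^sup>1\<close> minimizes
  \<open>G - \<langle>v\<^sup>l, \<cdot>\<rangle>\<close> up to \<open>\<epsilon>\<^sup>l\<close>, and it is a (mean gap)-subgradient of \<open>H\<close> at the same point because the cuts
  minorize \<open>H\<close>; both errors vanish, so along a subsequence \<open>v\<^sup>l\<close> tends to a common subgradient.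
\<close>

section \<open>Approximate subgradients\<close>

lemma eps_subdiff_ereal_iff:
  "v \<in> eps_subdiff e (\<lambda>y. ereal (f y)) x \<longleftrightarrow> (\<forall>y. f x + inner (y - x) v - e \<le> f y)"
  by (simp add: eps_subdiff_def)

lemma convexity_modulus_pos_iff_strongly_convex:
  fixes f :: "'a::real_inner \<Rightarrow> real"
  shows "convexity_modulus (\<lambda>y. ereal (f y)) > 0 \<longleftrightarrow>
    (\<exists>\<rho>>0. convex_on UNIV (\<lambda>y. f y - \<rho> / 2 * (norm y)\<^sup>2))"
proof -
  have "ext_convex (\<lambda>y. ereal (f y) - ereal (\<rho> / 2 * (norm y)\<^sup>2)) \<longleftrightarrow>
      convex_on UNIV (\<lambda>y. f y - \<rho> / 2 * (norm y)\<^sup>2)" for \<rho>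
    by (simp flip: ext_convex_ereal_iff)
  then have "convexity_modulus (\<lambda>y. ereal (f y)) =
      Sup {ereal \<rho> | \<rho>. \<rho> \<ge> 0 \<and> convex_on UNIV (\<lambda>y. f y - \<rho> / 2 * (norm y)\<^sup>2)}"
    unfolding convexity_modulus_def by simp
  also have "0 < \<dots> \<longleftrightarrow>
      (\<exists>\<rho>. 0 < ereal \<rho> \<and> \<rho> \<ge> 0 \<and> convex_on UNIV (\<lambda>y. f y - \<rho> / 2 * (norm y)\<^sup>2))"
    unfolding less_Sup_iff by blast
  finally show ?thesis
    by (auto intro: less_imp_le)
qed

text \<open>
  The subgradient inequality is evaluated at the midpoint of \<open>x\<close> and \<open>y\<close>, where strong convexity
  improves the convexity inequality by \<open>\<rho>/8 * \<parallel>y - x\<parallel>\<^sup>2\<close>. Doubling the resulting estimate doubles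
  the tolerance as well.
\<close>
lemma eps_subdiff_strongly_convex:
  fixes f :: "'a::real_inner \<Rightarrow> real"
  assumes "convex_on UNIV (\<lambda>y. f y - \<rho> / 2 * (norm y)\<^sup>2)"
    and "v \<in> eps_subdiff e (\<lambda>y. ereal (f y)) x"
  shows "f x + inner (y - x) v + \<rho> / 4 * (norm (y - x))\<^sup>2 - 2 * e \<le> f y"
proof -
  define m where "m = (1/2) *\<^sub>R x + (1/2) *\<^sub>R y"
  have m_x: "m - x = (1/2) *\<^sub>R (y - x)"
    by (simp add: m_def algebra_simps flip: scaleR_left.add)
  have "f m - \<rho> / 2 * (norm m)\<^sup>2 \<le>
      (1/2) * (f x - \<rho> / 2 * (norm x)\<^sup>2) + (1/2) * (f y - \<rho> / 2 * (norm y)\<^sup>2)"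
    using convex_onD[OF assms(1), of "1/2" x y] by (simp add: m_def)
  moreover have "(norm m)\<^sup>2 = (norm x)\<^sup>2 / 2 + (norm y)\<^sup>2 / 2 - (norm (y - x))\<^sup>2 / 4"
    by (simp add: m_def power2_norm_eq_inner inner_commute algebra_simps add_divide_distrib
        diff_divide_distrib)
  ultimately have "f m \<le> f x / 2 + f y / 2 - \<rho> / 8 * (norm (y - x))\<^sup>2"
    by (simp add: algebra_simps)
  moreover have "f x + inner (m - x) v - e \<le> f m"
    using assms(2) by (simp add: eps_subdiff_ereal_iff)
  ultimately show ?thesis
    by (simp add: m_x)
qed

text \<open>
  Moving from \<open>u j\<close> by the unit vector in the direction of \<open>w j\<close> increases \<open>f\<close> by at least
  \<open>\<parallel>w j\<parallel> - e j\<close>, while \<open>f\<close> is bounded on bounded sets.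
\<close>
lemma bounded_eps_subgradients:
  fixes f :: "'a::euclidean_space \<Rightarrow> real" and u w :: "nat \<Rightarrow> 'a"
  assumes "continuous_on UNIV f" "bounded (range u)" "bounded (range e)"
    and sub: "\<And>j. w j \<in> eps_subdiff (e j) (\<lambda>y. ereal (f y)) (u j)"
  shows "bounded (range w)"
proof -
  obtain R where R: "\<And>j. norm (u j) \<le> R"
    using \<open>bounded (range u)\<close> by (auto simp: bounded_iff)
  obtain E where E: "\<And>j. \<bar>e j\<bar> \<le> E"
    using \<open>bounded (range e)\<close> by (auto simp: bounded_iff)
  have "bounded (f ` cball 0 (R + 1))"
    by (intro compact_imp_bounded compact_continuous_image continuous_on_subset[OF assms(1)]) auto
  then obtain K where K: "\<And>y. norm y \<le> R + 1 \<Longrightarrow> \<bar>f y\<bar> \<le> K"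
    unfolding bounded_iff by (metis image_eqI mem_cball_0 real_norm_def)
  have "norm (w j) \<le> 2 * K + E" for j
  proof -
    have "norm (u j + sgn (w j)) \<le> R + 1"
      using norm_triangle_ineq[of "u j" "sgn (w j)"] R[of j] by (simp add: norm_sgn split: if_splits)
    moreover have "f (u j) + inner (sgn (w j)) (w j) - e j \<le> f (u j + sgn (w j))"
      using sub[of j] by (auto simp: eps_subdiff_ereal_iff dest: spec[of _ "u j + sgn (w j)"])
    moreover have "inner (sgn (w j)) (w j) = norm (w j)"
      by (cases "w j = 0") (simp_all add: sgn_div_norm power2_norm_eq_inner[symmetric] power2_eq_square)
    ultimately show ?thesis
      using K[of "u j + sgn (w j)"] K[of "u j"] R[of j] E[of j] by linarith
  qed
  then show ?thesis
    by (auto simp: bounded_iff)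
qed

text \<open>
  The graph of the approximate subdifferential is closed: for each \<open>y\<close> of finite value the
  inequality \<open>f (u j) \<le> f y - \<langle>y - u j, w j\<rangle> + e j\<close> passes to the limit. Finiteness of \<open>f z\<close> comes out of the
  same inequality, with any \<open>y\<close> in the effective domain.
\<close>
lemma eps_subdiff_limit:
  fixes f :: "'a::real_inner \<Rightarrow> ereal"
  assumes lsc: "f z \<le> liminf (\<lambda>j. f (u j))" and "proper_fun f"
    and "u \<longlonglongrightarrow> z" "w \<longlonglongrightarrow> p" "e \<longlonglongrightarrow> 0"
    and sub: "\<And>j. w j \<in> eps_subdiff (e j) f (u j)"
  shows "p \<in> subdiff f z"
proof -
  have bound: "f z \<le> f y - ereal (inner (y - z) p)" if "f y < \<infinity>" for y
  proof -
    obtain r where r: "f y = ereal r"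
      using \<open>f y < \<infinity>\<close> \<open>proper_fun f\<close> that unfolding proper_fun_def
      by (metis ereal_cases less_irrefl)
    have "f (u j) \<le> ereal (r - inner (y - u j) (w j) + e j)" for j
    proof -
      have "f (u j) + ereal (inner (y - u j) (w j)) - ereal (e j) \<le> ereal r"
        using sub[of j] r unfolding eps_subdiff_def by (auto dest: spec[of _ y])
      then show ?thesis
        by (cases "f (u j)") auto
    qed
    then have "liminf (\<lambda>j. f (u j)) \<le> liminf (\<lambda>j. ereal (r - inner (y - u j) (w j) + e j))"
      by (intro Liminf_mono) auto
    also have "\<dots> = ereal (r - inner (y - z) p + 0)"
      by (intro lim_imp_Liminf tendsto_intros assms) auto
    finally show ?thesis
      using lsc r by auto
  qed
  obtain y0 where "f y0 < \<infinity>"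
    using \<open>proper_fun f\<close> by (auto simp: proper_fun_def)
  with bound[of y0] \<open>proper_fun f\<close> have "f z < \<infinity>"
    by (cases "f y0") (auto simp: proper_fun_def)
  moreover have "f y \<ge> f z + ereal (inner (y - z) p)" for y
  proof (cases "f y < \<infinity>")
    case True
    with bound[OF this] \<open>proper_fun f\<close> \<open>f z < \<infinity>\<close> show ?thesis
      by (cases "f y"; cases "f z") (auto simp: proper_fun_def)
  qed simp
  ultimately show ?thesis
    by (simp add: eps_subdiff_def)
qed

text \<open>
  The filter \<open>at z\<close> in \<^const>\<open>lsc_fun\<close> omits \<open>z\<close> itself; since \<open>c < f z\<close> holds at \<open>z\<close> too, sequences that
  hit \<open>z\<close> are covered.
\<close>
lemma lsc_fun_le_liminf:
  fixes f :: "'a::topological_space \<Rightarrow> ereal"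
  assumes "lsc_fun f" "u \<longlonglongrightarrow> z"
  shows "f z \<le> liminf (\<lambda>j. f (u j))"
  unfolding le_Liminf_iff
proof (intro allI impI)
  fix c assume "c < f z"
  moreover have "f z \<le> Liminf (at z) f"
    using assms(1) by (simp add: lsc_fun_def)
  ultimately have "eventually (\<lambda>y. c < f y) (nhds z)"
    by (auto simp: le_Liminf_iff eventually_nhds_conv_at)
  then show "\<forall>\<^sub>F j in sequentially. c < f (u j)"
    using assms(2) by (auto simp: filterlim_iff)
qed

lemma sum_neq_MInfty:
  fixes f :: "'i \<Rightarrow> ereal"
  assumes "\<And>i. i \<in> I \<Longrightarrow> f i \<noteq> -\<infinity>"
  shows "sum f I \<noteq> -\<infinity>"
  using assms by (induction I rule: infinite_finite_induct) auto

lemma sum_lsc_le_liminf: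
  fixes f :: "'i \<Rightarrow> 'a::topological_space \<Rightarrow> ereal"
  assumes "finite I" "u \<longlonglongrightarrow> z"
    and "\<And>i. i \<in> I \<Longrightarrow> lsc_fun (f i)" "\<And>i y. i \<in> I \<Longrightarrow> f i y \<noteq> -\<infinity>"
  shows "(\<Sum>i\<in>I. f i z) \<le> liminf (\<lambda>j. \<Sum>i\<in>I. f i (u j))"
  using assms
proof (induction I rule: finite_induct)
  case (insert i I)
  have le: "f i z \<le> liminf (\<lambda>j. f i (u j))" "(\<Sum>i\<in>I. f i z) \<le> liminf (\<lambda>j. \<Sum>i\<in>I. f i (u j))"
    using insert by (auto intro: lsc_fun_le_liminf)
  have "f i z \<noteq> -\<infinity>" "(\<Sum>i\<in>I. f i z) \<noteq> -\<infinity>"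
    using insert.prems by (auto intro!: sum_neq_MInfty)
  with le have "liminf (\<lambda>j. f i (u j)) + liminf (\<lambda>j. \<Sum>i\<in>I. f i (u j))
      \<le> liminf (\<lambda>j. f i (u j) + (\<Sum>i\<in>I. f i (u j)))"
    by (intro ereal_liminf_add_mono) auto
  with insert le show ?case
    by (auto intro: order_trans[OF add_mono])
qed (simp add: Liminf_const)

section \<open>Almost decreasing sequences\<close>

text \<open>
  Subtracting the partial sums of \<open>e\<close> from \<open>U\<close> leaves a decreasing sequence that is bounded below;
  telescoping bounds the partial sums of \<open>d\<close>.
\<close>
lemma almost_decreasing_convergent:
  fixes U d e :: "nat \<Rightarrow> real"
  assumes step: "\<And>l. U (Suc l) \<le> U l - d l + e l"
    and "\<And>l. c \<le> U l" "\<And>l. 0 \<le> d l" and "summable e"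
  shows "convergent U" "summable d"
proof -
  define S where "S l = (\<Sum>k<l. e k)" for l
  have "S \<longlonglongrightarrow> suminf e"
    using \<open>summable e\<close> unfolding S_def by (rule summable_LIMSEQ)
  then obtain K where K: "\<And>l. \<bar>S l\<bar> \<le> K"
    using convergent_imp_Bseq[of S] by (auto simp: Bseq_def convergent_def)
  have "decseq (\<lambda>l. U l - S l)"
    using step \<open>\<And>l. 0 \<le> d l\<close> by (intro decseq_SucI) (smt (verit) S_def sum.lessThan_Suc)
  moreover have "c - K \<le> U l - S l" for l
    using assms(2)[of l] K[of l] by linarith
  ultimately obtain L where "(\<lambda>l. U l - S l) \<longlonglongrightarrow> L"
    using decseq_convergent by metis
  from tendsto_add[OF this \<open>S \<longlonglongrightarrow> suminf e\<close>] show "convergent U"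
    by (auto simp: convergent_def)
  have "(\<Sum>k<l. d k) \<le> U 0 - U l + S l" for l
    using step by (induction l) (auto simp: S_def intro: order_trans, smt (verit))
  moreover have "U 0 - U l + S l \<le> U 0 - c + K" for l
    using assms(2)[of l] K[of l] by linarith
  ultimately have "(\<Sum>k<l. d k) \<le> U 0 - c + K" for l
    using order_trans by blast
  then show "summable d"
    using assms(3) by (intro summableI_nonneg_bounded)
qed

section \<open>Series observed at random times\<close>

text \<open>
  Terms are counted only while the sum of their predecessors is at most \<open>C\<close>, so the total exceeds
  \<open>C\<close> by at most the last term counted.
\<close>
lemma stopped_sum_le:
  fixes t :: "nat \<Rightarrow> real"
  assumes "\<And>k. 0 \<le> t k" "\<And>k. t k \<le> 1" "0 \<le> C"
  shows "(\<Sum>k<N. if (\<Sum>j<k. t j) \<le> C then t k else 0) \<le> C + 1"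
proof (induction N)
  case (Suc N)
  have "(\<Sum>k<N. if (\<Sum>j<k. t j) \<le> C then t k else 0) \<le> (\<Sum>k<N. t k)"
    using assms by (intro sum_mono) auto
  with Suc assms(2)[of N] show ?case
    by auto
qed (use assms in auto)

lemma summable_min_one_iff:
  fixes a :: "nat \<Rightarrow> real"
  assumes "\<And>l. 0 \<le> a l"
  shows "summable (\<lambda>l. min (a l) 1) \<longleftrightarrow> summable a"
proof
  assume "summable (\<lambda>l. min (a l) 1)"
  then have "eventually (\<lambda>l. min (a l) 1 < 1) sequentially"
    by (intro order_tendstoD(2)[of _ 0] summable_LIMSEQ_zero) auto
  then have "eventually (\<lambda>l. min (a l) 1 = a l) sequentially"
    by eventually_elim auto
  from summable_cong[OF this] \<open>summable (\<lambda>l. min (a l) 1)\<close> show "summable a"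
    by simp
next
  assume "summable a"
  then show "summable (\<lambda>l. min (a l) 1)"
    by (rule summable_comparison_test'[where N = 0]) (use assms in auto)
qed

text \<open>
  Let \<open>S l\<close> be the sum of the terms observed before \<open>l\<close>, and stop at level \<open>C\<close> by putting \<open>D l = A l\<close> as
  long as \<open>S l \<le> C\<close> and \<open>D l = 0\<close> afterwards. Since \<open>D l\<close> is known at the time when \<open>B l\<close> is drawn,
  the observed part of \<open>\<Sum>l. D l\<close> has expectation \<open>p\<close> times that of the whole series. The
  observed part is at most \<open>C + 1\<close>, so \<open>\<Sum>l. D l\<close> has finite expectation and is finite almost surely.
  On the event that all observed terms add up to at most \<open>C\<close>, \<open>D\<close> is \<open>A\<close>, and the events for
  \<open>C = 0, 1, 2, \<dots>\<close> exhaust the space up to a null set. The stopping is what allows the argument to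
  work when the observed sum is finite but not integrable.
\<close>
lemma (in prob_space) AE_summable_of_sampled_bounded:
  fixes A :: "nat \<Rightarrow> 'a \<Rightarrow> real" and B :: "nat \<Rightarrow> 'a set" and \<F> :: "nat \<Rightarrow> 'a measure"
  assumes sub: "\<And>l. subalgebra M (\<F> l)"
    and A_meas: "\<And>k l. k \<le> l \<Longrightarrow> A k \<in> borel_measurable (\<F> l)"
    and B_past: "\<And>k l. k < l \<Longrightarrow> B k \<in> sets (\<F> l)"
    and A_nonneg: "\<And>l \<omega>. \<omega> \<in> space M \<Longrightarrow> 0 \<le> A l \<omega>"
    and A_le_1: "\<And>l \<omega>. \<omega> \<in> space M \<Longrightarrow> A l \<omega> \<le> 1"
    and cond: "\<And>l. AE \<omega> in M. real_cond_exp M (\<F> l) (indicator (B l)) \<omega> = p"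
    and "0 < p"
    and sampled: "AE \<omega> in M. summable (\<lambda>l. indicator (B l) \<omega> * A l \<omega>)"
  shows "AE \<omega> in M. summable (\<lambda>l. A l \<omega>)"
proof -
  have B_M [measurable]: "B l \<in> sets M" for l
    using B_past[of l "Suc l"] sub[of "Suc l"] by (auto simp: subalgebra_def)
  have A_M [measurable]: "A l \<in> borel_measurable M" for l
    using measurable_from_subalg[OF sub A_meas] by blast
  define S where "S l \<omega> = (\<Sum>k<l. indicator (B k) \<omega> * A k \<omega>)" for l \<omega>
  have S_meas: "S l \<in> borel_measurable (\<F> l)" for l
    unfolding S_def
    by (intro borel_measurable_sum borel_measurable_times borel_measurable_indicator A_meas B_past) auto
  have S_M [measurable]: "S l \<in> borel_measurable M" for l
    using measurable_from_subalg[OF sub S_meas] .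
  have stopped: "AE \<omega> in M. summable (\<lambda>l. if S l \<omega> \<le> C then A l \<omega> else 0)" if "0 \<le> C" for C :: real
  proof -
    define D where "D l \<omega> = (if S l \<omega> \<le> C then A l \<omega> else 0)" for l \<omega>
    have D_meas: "D l \<in> borel_measurable (\<F> l)" for l
    proof -
      note [measurable] = S_meas[of l] A_meas[OF order_refl, of l]
      show ?thesis unfolding D_def by measurable
    qed
    have D_M [measurable]: "D l \<in> borel_measurable M" for l
      using measurable_from_subalg[OF sub D_meas] .
    have D_01: "0 \<le> D l \<omega>" "D l \<omega> \<le> 1" if "\<omega> \<in> space M" for l \<omega>
      using A_nonneg A_le_1 that by (auto simp: D_def)
    have D_int: "integrable M (D l)" for l
      using D_01 by (intro integrable_const_bound[where B = 1]) auto
    have DB_int: "integrable M (\<lambda>\<omega>. D l \<omega> * indicator (B l) \<omega>)" for l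
      using D_01 by (intro integrable_const_bound[where B = 1]) (auto simp: indicator_def)
    have sampled_expectation:
      "expectation (\<lambda>\<omega>. D l \<omega> * indicator (B l) \<omega>) = p * expectation (D l)" for l
    proof -
      interpret finite_measure_subalgebra M "\<F> l"
        by unfold_locales (rule sub)
      have "expectation (\<lambda>\<omega>. D l \<omega> * indicator (B l) \<omega>) =
          expectation (\<lambda>\<omega>. D l \<omega> * real_cond_exp M (\<F> l) (indicator (B l)) \<omega>)"
        by (rule real_cond_exp_intg(2)[symmetric]) (use DB_int D_meas in auto)
      also have "\<dots> = expectation (\<lambda>\<omega>. D l \<omega> * p)"
        using cond[of l] by (intro integral_cong_AE) auto
      finally show ?thesis
        by simp
    qed
    have "p * (\<Sum>l<N. expectation (D l)) \<le> C + 1" for N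
    proof -
      have "p * (\<Sum>l<N. expectation (D l)) = expectation (\<lambda>\<omega>. \<Sum>l<N. D l \<omega> * indicator (B l) \<omega>)"
        by (subst Bochner_Integration.integral_sum)
           (use DB_int in \<open>auto simp only: sampled_expectation sum_distrib_left\<close>)
      also have "\<dots> \<le> expectation (\<lambda>\<omega>. C + 1)"
      proof (rule integral_mono_AE)
        show "AE \<omega> in M. (\<Sum>l<N. D l \<omega> * indicator (B l) \<omega>) \<le> C + 1"
        proof (rule AE_I2)
          fix \<omega> assume "\<omega> \<in> space M"
          with stopped_sum_le[of "\<lambda>k. indicator (B k) \<omega> * A k \<omega>" C N] \<open>0 \<le> C\<close> A_nonneg A_le_1
          have "(\<Sum>l<N. if S l \<omega> \<le> C then indicator (B l) \<omega> * A l \<omega> else 0) \<le> C + 1"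
            by (simp add: S_def indicator_def)
          moreover have "(if S l \<omega> \<le> C then indicator (B l) \<omega> * A l \<omega> else 0) = D l \<omega> * indicator (B l) \<omega>" for l
            by (simp add: D_def)
          ultimately show "(\<Sum>l<N. D l \<omega> * indicator (B l) \<omega>) \<le> C + 1"
            by simp
        qed
      next
        show "integrable M (\<lambda>\<omega>. \<Sum>l<N. D l \<omega> * indicator (B l) \<omega>)"
          by (intro Bochner_Integration.integrable_sum DB_int)
      qed auto
      finally show ?thesis
        by (simp add: prob_space)
    qed
    then have "(\<Sum>l<N. expectation (D l)) \<le> (C + 1) / p" for N
      using \<open>0 < p\<close> by (simp add: field_simps)
    then have sum_exp: "summable (\<lambda>l. expectation (D l))"
      using D_01 by (intro summableI_nonneg_bounded integral_nonneg_AE) auto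
    have "(\<integral>\<^sup>+\<omega>. (\<Sum>l. ennreal (D l \<omega>)) \<partial>M) = (\<Sum>l. \<integral>\<^sup>+\<omega>. ennreal (D l \<omega>) \<partial>M)"
      by (rule nn_integral_suminf) auto
    also have "\<dots> = (\<Sum>l. ennreal (expectation (D l)))"
      using D_01 D_int by (simp add: nn_integral_eq_integral)
    also have "\<dots> = ennreal (\<Sum>l. expectation (D l))"
      using D_01 sum_exp by (intro suminf_ennreal2 integral_nonneg_AE) auto
    finally have "AE \<omega> in M. (\<Sum>l. ennreal (D l \<omega>)) \<noteq> \<infinity>"
      by (intro nn_integral_PInf_AE) auto
    then have "AE \<omega> in M. summable (\<lambda>l. D l \<omega>)"
      using AE_space by eventually_elim (auto intro: summable_suminf_not_top D_01)
    then show ?thesis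
      by (simp add: D_def)
  qed
  have "AE \<omega> in M. \<forall>C::nat. summable (\<lambda>l. if S l \<omega> \<le> real C then A l \<omega> else 0)"
    using stopped by (simp add: AE_all_countable)
  with sampled AE_space show ?thesis
  proof eventually_elim
    case (elim \<omega>)
    obtain C :: nat where "(\<Sum>k. indicator (B k) \<omega> * A k \<omega>) \<le> real C"
      using real_arch_simple by blast
    moreover have "S l \<omega> \<le> (\<Sum>k. indicator (B k) \<omega> * A k \<omega>)" for l
      unfolding S_def using elim A_nonneg by (intro sum_le_suminf) auto
    ultimately have "S l \<omega> \<le> real C" for l
      using order_trans by blast
    with elim show ?case
      by (auto dest: spec[of _ C])
  qed
qed

text \<open>
  Truncating the terms at \<open>1\<close> does not affect summability, and it bounds the term at which the
  observed sum crosses a given level.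
\<close>
lemma (in prob_space) AE_summable_of_sampled:
  fixes A :: "nat \<Rightarrow> 'a \<Rightarrow> real" and B :: "nat \<Rightarrow> 'a set" and \<F> :: "nat \<Rightarrow> 'a measure"
  assumes sub: "\<And>l. subalgebra M (\<F> l)"
    and A_meas: "\<And>k l. k \<le> l \<Longrightarrow> A k \<in> borel_measurable (\<F> l)"
    and B_past: "\<And>k l. k < l \<Longrightarrow> B k \<in> sets (\<F> l)"
    and A_nonneg: "\<And>l \<omega>. \<omega> \<in> space M \<Longrightarrow> 0 \<le> A l \<omega>"
    and cond: "\<And>l. AE \<omega> in M. real_cond_exp M (\<F> l) (indicator (B l)) \<omega> = p"
    and "0 < p"
    and sampled: "AE \<omega> in M. summable (\<lambda>l. indicator (B l) \<omega> * A l \<omega>)"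
  shows "AE \<omega> in M. summable (\<lambda>l. A l \<omega>)"
proof -
  have "AE \<omega> in M. summable (\<lambda>l. min (A l \<omega>) 1)"
  proof (rule AE_summable_of_sampled_bounded[OF sub _ B_past _ _ cond \<open>0 < p\<close>])
    show "(\<lambda>\<omega>. min (A k \<omega>) 1) \<in> borel_measurable (\<F> l)" if "k \<le> l" for k l
      using A_meas[OF that] by measurable
    show "AE \<omega> in M. summable (\<lambda>l. indicator (B l) \<omega> * min (A l \<omega>) 1)"
      using sampled AE_space
    proof eventually_elim
      case (elim \<omega>)
      then show ?case
        using A_nonneg
        by (intro summable_comparison_test'[OF elim(1), of 0]) (auto simp: indicator_def)
    qed
  qed (use A_nonneg in auto)
  then show ?thesis
    using AE_space by eventually_elim (use A_nonneg in \<open>simp add: summable_min_one_iff\<close>)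
qed

section \<open>A single trajectory\<close>

text \<open>
  The constant term of the cut \<open>y \<mapsto> c + \<langle>y, v l i\<rangle>\<close>. It is kept together with \<open>v l i\<close> while
  component \<open>i\<close> is not selected, and it absorbs the tolerance of the last refresh.
\<close>
primrec cut_intercept ::
  "(nat \<Rightarrow> 'a::real_inner \<Rightarrow> real) \<Rightarrow> (nat \<Rightarrow> 'a) \<Rightarrow> (nat \<Rightarrow> real) \<Rightarrow> (nat \<Rightarrow> nat set) \<Rightarrow>
   (nat \<Rightarrow> nat \<Rightarrow> 'a) \<Rightarrow> nat \<Rightarrow> nat \<Rightarrow> real" where
  "cut_intercept h x \<epsilon> s v i 0 = h i (x 0) - \<epsilon> 0 - inner (x 0) (v 0 i)"
| "cut_intercept h x \<epsilon> s v i (Suc l) =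
    (if i \<in> s (Suc l) then h i (x (Suc l)) - \<epsilon> (Suc l) - inner (x (Suc l)) (v (Suc l) i)
     else cut_intercept h x \<epsilon> s v i l)"

definition cut_gap ::
  "(nat \<Rightarrow> 'a::real_inner \<Rightarrow> real) \<Rightarrow> (nat \<Rightarrow> 'a) \<Rightarrow> (nat \<Rightarrow> real) \<Rightarrow> (nat \<Rightarrow> nat set) \<Rightarrow>
   (nat \<Rightarrow> nat \<Rightarrow> 'a) \<Rightarrow> nat \<Rightarrow> nat \<Rightarrow> real" where
  "cut_gap h x \<epsilon> s v i l =
    h i (x (Suc l)) - (cut_intercept h x \<epsilon> s v i l + inner (x (Suc l)) (v l i))"

text \<open>The conditions that one realization of the algorithm satisfies, whatever the law of the subsets.\<close>
locale isdca_path =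
  fixes n :: nat and G :: "'a::euclidean_space \<Rightarrow> ereal" and h :: "nat \<Rightarrow> 'a \<Rightarrow> real"
    and x :: "nat \<Rightarrow> 'a" and \<epsilon> :: "nat \<Rightarrow> real" and s :: "nat \<Rightarrow> nat set" and v :: "nat \<Rightarrow> nat \<Rightarrow> 'a"
  assumes n_pos: "1 \<le> n"
    and G_proper: "proper_fun G"
    and tol_nonneg: "0 \<le> \<epsilon> l"
    and s_0: "s 0 = {1..n}"
    and s_subset: "s l \<subseteq> {1..n}"
    and s_nonempty: "s l \<noteq> {}"
    and fresh: "i \<in> s l \<Longrightarrow> v l i \<in> eps_subdiff (\<epsilon> l) (\<lambda>y. ereal (h i y)) (x l)"
    and stale: "i \<in> {1..n} - s (Suc l) \<Longrightarrow> v (Suc l) i = v l i"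
    and minimize: "eps_solution (\<epsilon> l)
      (\<lambda>y. G y - ereal (inner ((1 / real n) *\<^sub>R (\<Sum>i=1..n. v l i)) y)) (x (Suc l))"
begin

abbreviation "c \<equiv> cut_intercept h x \<epsilon> s v"
abbreviation "gap \<equiv> cut_gap h x \<epsilon> s v"

definition mean_v :: "nat \<Rightarrow> 'a" where
  "mean_v l = (1 / real n) *\<^sub>R (\<Sum>i=1..n. v l i)"

definition H :: "'a \<Rightarrow> real" where
  "H y = 1 / real n * (\<Sum>i=1..n. h i y)"

definition Gx :: "nat \<Rightarrow> real" where
  "Gx l = real_of_ereal (G (x (Suc l)))"

definition mean_gap :: "nat \<Rightarrow> real" where
  "mean_gap l = 1 / real n * (\<Sum>i=1..n. gap i l)"

definition model_value :: "nat \<Rightarrow> real" where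
  "model_value l = Gx l - 1 / real n * (\<Sum>i=1..n. c i l + inner (x (Suc l)) (v l i))"

lemma inner_mean_v: "inner y (mean_v l) = 1 / real n * (\<Sum>i=1..n. inner y (v l i))"
  by (simp add: mean_v_def inner_sum_right)

lemma cut_intercept_fresh:
  "i \<in> s l \<Longrightarrow> c i l = h i (x l) - \<epsilon> l - inner (x l) (v l i)"
  by (cases l) auto

lemma cut_le:
  assumes "i \<in> {1..n}"
  shows "c i l + inner y (v l i) \<le> h i y"
proof (induction l)
  case 0
  with fresh[of i 0] assms show ?case
    by (auto simp: s_0 eps_subdiff_ereal_iff inner_diff_left algebra_simps)
next
  case (Suc l)
  with fresh[of i "Suc l"] stale[of i l] assms show ?case
    by (auto simp: eps_subdiff_ereal_iff inner_diff_left algebra_simps)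
qed

lemma gap_nonneg: "i \<in> {1..n} \<Longrightarrow> 0 \<le> gap i l"
  using cut_le[of i l "x (Suc l)"] by (simp add: cut_gap_def)

lemma mean_gap_nonneg: "0 \<le> mean_gap l"
  unfolding mean_gap_def by (intro mult_nonneg_nonneg sum_nonneg gap_nonneg) auto

text \<open>
  Approximate minimality of \<open>x (Suc l)\<close> for \<open>G - \<langle>mean_v l, \<cdot>\<rangle>\<close> is this inclusion after rearrangement.
  Since \<open>G\<close> is proper, it also makes \<open>G\<close> finite at every iterate except possibly the initial one.
\<close>
lemma G_subgradient: "mean_v l \<in> eps_subdiff (\<epsilon> l) G (x (Suc l))"
proof -
  obtain y0 where "G y0 < \<infinity>" and not_MInf: "\<And>y. G y \<noteq> -\<infinity>"
    using G_proper by (auto simp: proper_fun_def)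
  have le: "G (x (Suc l)) - ereal (inner (mean_v l) (x (Suc l)))
      \<le> G y - ereal (inner (mean_v l) y) + ereal (\<epsilon> l)" for y
    using minimize[of l] by (simp add: eps_solution_def mean_v_def)
  have fin: "G (x (Suc l)) < \<infinity>"
    using le[of y0] \<open>G y0 < \<infinity>\<close> not_MInf[of y0] by (cases "G y0"; cases "G (x (Suc l))") auto
  moreover have "G (x (Suc l)) + ereal (inner (y - x (Suc l)) (mean_v l)) - ereal (\<epsilon> l) \<le> G y" for y
    using le[of y] fin not_MInf[of y] not_MInf[of "x (Suc l)"]
    by (cases "G y"; cases "G (x (Suc l))")
       (auto simp: inner_diff_left inner_diff_right inner_commute)
  ultimately show ?thesis
    by (simp add: eps_subdiff_def)
qed

lemma G_iterate: "G (x (Suc l)) = ereal (Gx l)"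
  using G_subgradient[of l] G_proper
  by (cases "G (x (Suc l))") (auto simp: Gx_def eps_subdiff_def proper_fun_def)

text \<open>
  The mean of the cuts is an affine minorant of \<open>H\<close> with slope \<open>mean_v l\<close>, lying \<open>mean_gap l\<close> below \<open>H\<close>
  at \<open>x (Suc l)\<close>. The inclusion thus holds at the current iterate although the components of
  \<open>mean_v l\<close> were computed at various earlier ones.
\<close>
lemma H_subgradient: "mean_v l \<in> eps_subdiff (mean_gap l) (\<lambda>y. ereal (H y)) (x (Suc l))"
proof -
  have "H (x (Suc l)) + inner (y - x (Suc l)) (mean_v l) - mean_gap l
      = 1 / real n * (\<Sum>i=1..n. c i l + inner y (v l i))" for y
    by (simp add: H_def inner_mean_v mean_gap_def cut_gap_def inner_diff_left sum.distrib
        sum_subtractf add_divide_distrib diff_divide_distrib)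
  also have "1 / real n * (\<Sum>i=1..n. c i l + inner y (v l i)) \<le> H y" for y
    unfolding H_def by (intro mult_left_mono sum_mono cut_le) auto
  finally show ?thesis
    by (simp add: eps_subdiff_ereal_iff)
qed

lemma model_value_eq: "model_value l = (Gx l - H (x (Suc l))) + mean_gap l"
  by (simp add: model_value_def H_def mean_gap_def cut_gap_def sum_subtractf diff_divide_distrib)

text \<open>
  One \<open>\<epsilon> (Suc l)\<close> is lost in the approximate minimization. The other bounds the tolerances in the
  refreshed cuts, of which there are at most \<open>n\<close>, each with weight \<open>1 / n\<close>.
\<close>
lemma model_value_step:
  "model_value (Suc l) \<le> model_value l
     - 1 / real n * (\<Sum>i\<in>s (Suc l). gap i l) + 2 * \<epsilon> (Suc l)"
proof -
  let ?z = "x (Suc l)" and ?z' = "x (Suc (Suc l))"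
  have min: "Gx (Suc l) - inner ?z' (mean_v (Suc l)) \<le> Gx l - inner ?z (mean_v (Suc l)) + \<epsilon> (Suc l)"
    using G_subgradient[of "Suc l"] G_iterate[of l] G_iterate[of "Suc l"]
    by (auto simp: eps_subdiff_def inner_diff_left dest!: spec[of _ ?z])
  have refresh: "c i (Suc l) + inner ?z (v (Suc l) i) =
      c i l + inner ?z (v l i) + (if i \<in> s (Suc l) then gap i l - \<epsilon> (Suc l) else 0)"
    if "i \<in> {1..n}" for i
    using that stale[of i l] by (auto simp: cut_gap_def)
  have "card (s (Suc l)) \<le> n"
    using card_mono[OF _ s_subset[of "Suc l"]] by simp
  then have "1 / real n * (real (card (s (Suc l))) * \<epsilon> (Suc l)) \<le> \<epsilon> (Suc l)"
    using n_pos mult_right_mono[OF _ tol_nonneg[of "Suc l"], of "real (card (s (Suc l)))" "real n"]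
    by (simp add: divide_le_eq mult.commute)
  moreover have total: "(\<Sum>i=1..n. c i (Suc l) + inner ?z (v (Suc l) i)) =
      (\<Sum>i=1..n. c i l + inner ?z (v l i)) + (\<Sum>i\<in>s (Suc l). gap i l)
        - real (card (s (Suc l))) * \<epsilon> (Suc l)"
  proof -
    have "(\<Sum>i=1..n. c i (Suc l) + inner ?z (v (Suc l) i)) =
        (\<Sum>i=1..n. c i l + inner ?z (v l i)) +
        (\<Sum>i=1..n. if i \<in> s (Suc l) then gap i l - \<epsilon> (Suc l) else 0)"
      by (simp only: sum.cong[OF refl refresh] flip: sum.distrib)
    also have "(\<Sum>i=1..n. if i \<in> s (Suc l) then gap i l - \<epsilon> (Suc l) else 0) =
        (\<Sum>i\<in>s (Suc l). gap i l - \<epsilon> (Suc l))"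
      using s_subset[of "Suc l"] by (simp only: Int_absorb1 flip: sum.inter_restrict[OF finite_atLeastAtMost])
    finally show ?thesis
      by (simp only: sum_subtractf sum_constant)
  qed
  ultimately show ?thesis
    using min arg_cong[OF total, of "\<lambda>t. 1 / real n * t"]
    unfolding model_value_def inner_mean_v sum.distrib distrib_left right_diff_distrib
    by linarith
qed

lemma model_value_and_sampled_gaps:
  assumes "\<And>y. ereal \<alpha> \<le> G y - ereal (H y)" and "summable \<epsilon>"
  shows "convergent model_value" "summable (\<lambda>l. 1 / real n * (\<Sum>i\<in>s (Suc l). gap i l))"
proof -
  have lower: "\<alpha> \<le> model_value l" for l
    using assms(1)[of "x (Suc l)"] mean_gap_nonneg[of l] by (simp add: model_value_eq G_iterate)
  have nonneg: "0 \<le> 1 / real n * (\<Sum>i\<in>s (Suc l). gap i l)" for l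
    by (intro mult_nonneg_nonneg sum_nonneg gap_nonneg subsetD[OF s_subset]) auto
  have summ: "summable (\<lambda>l. 2 * \<epsilon> (Suc l))"
    using \<open>summable \<epsilon>\<close> by (simp add: summable_Suc_iff)
  show "convergent model_value" "summable (\<lambda>l. 1 / real n * (\<Sum>i\<in>s (Suc l). gap i l))"
    using almost_decreasing_convergent[OF model_value_step lower nonneg summ] by auto
qed

lemma sampled_gap_summable:
  assumes "\<And>y. ereal \<alpha> \<le> G y - ereal (H y)" "summable \<epsilon>" "i \<in> {1..n}"
  shows "summable (\<lambda>l. if i \<in> s (Suc l) then gap i l else 0)"
proof (rule summable_comparison_test')
  show "summable (\<lambda>l. \<Sum>i\<in>s (Suc l). gap i l)"
    using summable_mult[OF model_value_and_sampled_gaps(2)[OF assms(1,2)], of "real n"] n_pos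
    by simp
  show "norm (if i \<in> s (Suc l) then gap i l else 0) \<le> (\<Sum>i\<in>s (Suc l). gap i l)" if "0 \<le> l" for l
  proof -
    have "finite (s (Suc l))" and nonneg: "\<And>i. i \<in> s (Suc l) \<Longrightarrow> 0 \<le> gap i l"
      using finite_subset[OF s_subset] gap_nonneg subsetD[OF s_subset] by auto
    with member_le_sum[of i "s (Suc l)" "\<lambda>i. gap i l"] show ?thesis
      by (auto intro: sum_nonneg)
  qed
qed

lemma mean_gap_tendsto_0:
  assumes "\<And>i. i \<in> {1..n} \<Longrightarrow> summable (gap i)"
  shows "mean_gap \<longlonglongrightarrow> 0"
proof -
  have "summable (\<lambda>l. 1 / real n * (\<Sum>i=1..n. gap i l))"
    using assms by (intro summable_mult summable_sum)
  then show ?thesis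
    using summable_LIMSEQ_zero unfolding mean_gap_def by blast
qed

lemma objective_convergent:
  assumes "\<And>y. ereal \<alpha> \<le> G y - ereal (H y)" "summable \<epsilon>"
    and "\<And>i. i \<in> {1..n} \<Longrightarrow> summable (gap i)"
  shows "\<exists>L::real. (\<lambda>l. G (x l) - ereal (H (x l))) \<longlonglongrightarrow> ereal L"
proof -
  obtain L where "model_value \<longlonglongrightarrow> L"
    using model_value_and_sampled_gaps(1)[OF assms(1,2)] by (auto simp: convergent_def)
  from tendsto_diff[OF this mean_gap_tendsto_0[OF assms(3)]]
  have "(\<lambda>l. Gx l - H (x (Suc l))) \<longlonglongrightarrow> L"
    by (simp add: model_value_eq)
  then have "(\<lambda>l. G (x (Suc l)) - ereal (H (x (Suc l)))) \<longlonglongrightarrow> ereal L"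
    by (simp add: G_iterate)
  then show ?thesis
    by (intro exI) (rule LIMSEQ_imp_Suc)
qed

text \<open>
  Some component was refreshed at \<open>x l\<close>; by strong convexity its gap at the next iterate bounds the
  squared step up to the current tolerance.
\<close>
lemma steps_square_summable:
  assumes strong: "\<And>i. i \<in> {1..n} \<Longrightarrow> convexity_modulus (\<lambda>y. ereal (h i y)) > 0"
    and "summable \<epsilon>" "\<And>i. i \<in> {1..n} \<Longrightarrow> summable (gap i)"
  shows "summable (\<lambda>l. (norm (x (Suc l) - x l))\<^sup>2)"
proof -
  have "\<forall>i\<in>{1..n}. \<exists>\<rho>>0. convex_on UNIV (\<lambda>y. h i y - \<rho> / 2 * (norm y)\<^sup>2)"
    using strong by (simp add: convexity_modulus_pos_iff_strongly_convex)
  then obtain \<rho> where \<rho>: "\<And>i. i \<in> {1..n} \<Longrightarrow> \<rho> i > (0::real)"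
    "\<And>i. i \<in> {1..n} \<Longrightarrow> convex_on UNIV (\<lambda>y. h i y - \<rho> i / 2 * (norm y)\<^sup>2)"
    by metis
  define r where "r = Min (\<rho> ` {1..n})"
  have "r > 0" and r_le: "\<And>i. i \<in> {1..n} \<Longrightarrow> r \<le> \<rho> i"
    using \<rho>(1) n_pos by (auto simp: r_def)
  have bound: "r / 4 * (norm (x (Suc l) - x l))\<^sup>2 \<le> (\<Sum>i=1..n. gap i l) + \<epsilon> l" for l
  proof -
    obtain i where i: "i \<in> s l" "i \<in> {1..n}"
      using s_nonempty[of l] s_subset[of l] by blast
    have "r / 4 * (norm (x (Suc l) - x l))\<^sup>2 \<le> \<rho> i / 4 * (norm (x (Suc l) - x l))\<^sup>2"
      using r_le[OF i(2)] by (intro mult_right_mono) auto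
    also have "\<dots> \<le> gap i l + \<epsilon> l"
      using eps_subdiff_strongly_convex[OF \<rho>(2)[OF i(2)] fresh[OF i(1)], of "x (Suc l)"]
        cut_intercept_fresh[OF i(1)]
      by (simp add: cut_gap_def inner_diff_left)
    also have "gap i l \<le> (\<Sum>i=1..n. gap i l)"
      using i(2) gap_nonneg by (intro member_le_sum) auto
    finally show ?thesis
      by simp
  qed
  have "summable (\<lambda>l. (\<Sum>i=1..n. gap i l) + \<epsilon> l)"
    by (intro summable_add summable_sum assms(2,3))
  then have "summable (\<lambda>l. r / 4 * (norm (x (Suc l) - x l))\<^sup>2)"
    by (rule summable_comparison_test'[where N = 0]) (use bound \<open>r > 0\<close> in simp)
  from summable_mult[OF this, of "4 / r"] \<open>r > 0\<close> show ?thesis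
    by simp
qed

text \<open>
  The vectors \<open>mean_v l\<close> are approximate subgradients of both \<open>G\<close> and \<open>H\<close> at \<open>x (Suc l)\<close>, with errors
  tending to \<open>0\<close>. They are bounded along a convergent subsequence of the iterates, so a further
  subsequence converges, and its limit lies in both subdifferentials.
\<close>
lemma limit_point_critical:
  assumes cont: "continuous_on UNIV H"
    and lsc: "\<And>u z. u \<longlonglongrightarrow> z \<Longrightarrow> G z \<le> liminf (\<lambda>j. G (u j))"
    and "summable \<epsilon>" "\<And>i. i \<in> {1..n} \<Longrightarrow> summable (gap i)"
    and "seq_limit_point x z"
  shows "critical_point G H z"
proof -
  obtain r where r: "strict_mono r" "(x \<circ> r) \<longlonglongrightarrow> z"
    using \<open>seq_limit_point x z\<close> by (auto simp: seq_limit_point_def)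
  \<comment> \<open>The vectors at hand for the iterate \<open>x (r j)\<close> carry the index \<open>r j - 1\<close>. Dropping \<open>r 0\<close>, which may
    be \<open>0\<close>, keeps the subtraction exact.\<close>
  define q where "q j = r (Suc j) - 1" for j
  have Suc_q: "Suc (q j) = r (Suc j)" for j
    using seq_suble[OF r(1), of "Suc j"] by (simp add: q_def)
  have q: "strict_mono q"
  proof (rule strict_monoI_Suc)
    show "q j < q (Suc j)" for j
      using strict_monoD[OF r(1), of "Suc j" "Suc (Suc j)"] Suc_q[of j] Suc_q[of "Suc j"] by simp
  qed
  have x_q: "(\<lambda>j. x (Suc (q j))) \<longlonglongrightarrow> z"
    using LIMSEQ_Suc[OF r(2)] by (simp add: Suc_q)
  have gap_q: "(\<lambda>j. mean_gap (q j)) \<longlonglongrightarrow> 0"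
    using LIMSEQ_subseq_LIMSEQ[OF mean_gap_tendsto_0[OF assms(4)] q] by (simp add: o_def)
  have tol_q: "(\<lambda>j. \<epsilon> (q j)) \<longlonglongrightarrow> 0"
    using LIMSEQ_subseq_LIMSEQ[OF summable_LIMSEQ_zero[OF \<open>summable \<epsilon>\<close>] q] by (simp add: o_def)
  have "bounded (range (\<lambda>j. mean_v (q j)))"
    using bounded_eps_subgradients[OF cont _ _ H_subgradient, of "\<lambda>j. q j"]
      convergent_imp_bounded[OF x_q] convergent_imp_bounded[OF gap_q] by simp
  then obtain p t where t: "strict_mono t" "(\<lambda>j. mean_v (q (t j))) \<longlonglongrightarrow> p"
    using bounded_imp_convergent_subsequence[of "\<lambda>j. mean_v (q j)"] by (auto simp: o_def)
  note sub = LIMSEQ_subseq_LIMSEQ[OF _ t(1), unfolded o_def]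
  have "p \<in> subdiff G z"
    by (rule eps_subdiff_limit[OF lsc G_proper sub[OF x_q] t(2) sub[OF tol_q] G_subgradient])
       (rule sub[OF x_q])
  moreover have "p \<in> subdiff (\<lambda>y. ereal (H y)) z"
  proof (rule eps_subdiff_limit[OF _ _ sub[OF x_q] t(2) sub[OF gap_q] H_subgradient])
    have "(\<lambda>j. H (x (Suc (q (t j))))) \<longlonglongrightarrow> H z"
      by (rule continuous_on_tendsto_compose[OF cont sub[OF x_q]]) auto
    then have "liminf (\<lambda>j. ereal (H (x (Suc (q (t j)))))) = ereal (H z)"
      by (intro lim_imp_Liminf) auto
    then show "ereal (H z) \<le> liminf (\<lambda>j. ereal (H (x (Suc (q (t j))))))"
      by simp
  qed (simp add: proper_fun_def)
  ultimately show ?thesis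
    by (auto simp: critical_point_def)
qed

end

section \<open>Measurability with respect to the history\<close>

lemma space_isdca_history [simp]: "space (isdca_history M n x \<epsilon> s v l) = space M"
  unfolding isdca_history_def by (rule space_measure_of) (auto simp: preimages_def)

lemma measurable_if_preimages_subset:
  assumes "preimages M N f \<subseteq> sets \<F>" "space \<F> = space M" "f \<in> space M \<rightarrow> space N"
  shows "f \<in> \<F> \<rightarrow>\<^sub>M N"
  using assms by (intro measurableI) (auto simp: preimages_def)

lemma isdca_history_generators:
  "k \<le> l \<Longrightarrow> preimages M borel (x k) \<subseteq> sets (isdca_history M n x \<epsilon> s v l)"
  "k \<le> l \<Longrightarrow> preimages M borel (\<epsilon> k) \<subseteq> sets (isdca_history M n x \<epsilon> s v l)"
  "k < l \<Longrightarrow> preimages M (count_space (Pow {1..n})) (s k) \<subseteq> sets (isdca_history M n x \<epsilon> s v l)"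
  "k < l \<Longrightarrow> i \<in> {1..n} \<Longrightarrow> preimages M borel (v k i) \<subseteq> sets (isdca_history M n x \<epsilon> s v l)"
proof -
  have eq: "sets (isdca_history M n x \<epsilon> s v l) = sigma_sets (space M)
     ((\<Union>k\<le>l. preimages M borel (x k)) \<union> (\<Union>k\<le>l. preimages M borel (\<epsilon> k)) \<union>
      (\<Union>k<l. preimages M (count_space (Pow {1..n})) (s k)) \<union>
      (\<Union>k<l. \<Union>i\<in>{1..n}. preimages M borel (v k i)))"
    unfolding isdca_history_def by (rule sets_measure_of) (auto simp: preimages_def)
  show "k \<le> l \<Longrightarrow> preimages M borel (x k) \<subseteq> sets (isdca_history M n x \<epsilon> s v l)"
    and "k \<le> l \<Longrightarrow> preimages M borel (\<epsilon> k) \<subseteq> sets (isdca_history M n x \<epsilon> s v l)"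
    and "k < l \<Longrightarrow> preimages M (count_space (Pow {1..n})) (s k) \<subseteq> sets (isdca_history M n x \<epsilon> s v l)"
    and "k < l \<Longrightarrow> i \<in> {1..n} \<Longrightarrow> preimages M borel (v k i) \<subseteq> sets (isdca_history M n x \<epsilon> s v l)"
    unfolding eq by (auto intro!: sigma_sets.Basic)
qed

lemma isdca_history_measurable:
  assumes s: "\<And>k. s k \<in> M \<rightarrow>\<^sub>M count_space (Pow {1..n})"
  shows "k \<le> l \<Longrightarrow> x k \<in> borel_measurable (isdca_history M n x \<epsilon> s v l)"
    and "k \<le> l \<Longrightarrow> \<epsilon> k \<in> borel_measurable (isdca_history M n x \<epsilon> s v l)"
    and "k < l \<Longrightarrow> s k \<in> isdca_history M n x \<epsilon> s v l \<rightarrow>\<^sub>M count_space (Pow {1..n})"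
    and "k < l \<Longrightarrow> i \<in> {1..n} \<Longrightarrow> v k i \<in> borel_measurable (isdca_history M n x \<epsilon> s v l)"
proof -
  note measurableI' = measurable_if_preimages_subset[where M = M, OF _ space_isdca_history]
  show "x k \<in> borel_measurable (isdca_history M n x \<epsilon> s v l)" if "k \<le> l"
    by (rule measurableI'[OF isdca_history_generators(1)[OF that]]) auto
  show "\<epsilon> k \<in> borel_measurable (isdca_history M n x \<epsilon> s v l)" if "k \<le> l"
    by (rule measurableI'[OF isdca_history_generators(2)[OF that]]) auto
  show "s k \<in> isdca_history M n x \<epsilon> s v l \<rightarrow>\<^sub>M count_space (Pow {1..n})" if "k < l"
    by (rule measurableI'[OF isdca_history_generators(3)[OF that]])
       (rule Pi_I, rule measurable_space[OF s])
  show "v k i \<in> borel_measurable (isdca_history M n x \<epsilon> s v l)" if "k < l" "i \<in> {1..n}"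
    by (rule measurableI'[OF isdca_history_generators(4)[OF that]]) auto
qed

text \<open>
  The gap with index \<open>k\<close> involves the iterate \<open>x (Suc k)\<close>, but subsets, tolerances and vectors only up
  to \<open>k\<close>. All of these belong to the history at any \<open>l > k\<close>, on which the draw of \<open>s (Suc k)\<close> is conditioned
  when \<open>l = Suc k\<close>.
\<close>
lemma cut_gap_history_measurable:
  fixes x :: "nat \<Rightarrow> 'w \<Rightarrow> 'a::euclidean_space"
  assumes s: "\<And>k. s k \<in> M \<rightarrow>\<^sub>M count_space (Pow {1..n})"
    and cont: "continuous_on UNIV (h i)" and i: "i \<in> {1..n}" and "k < l"
  shows "(\<lambda>\<omega>. cut_gap h (\<lambda>l. x l \<omega>) (\<lambda>l. \<epsilon> l \<omega>) (\<lambda>l. s l \<omega>) (\<lambda>l i. v l i \<omega>) i k)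
    \<in> borel_measurable (isdca_history M n x \<epsilon> s v l)"
proof -
  let ?\<F> = "isdca_history M n x \<epsilon> s v l"
  have h: "h i \<in> borel_measurable borel"
    using cont by (rule borel_measurable_continuous_onI)
  note meas = isdca_history_measurable[OF s]
  have hx: "(\<lambda>\<omega>. h i (x j \<omega>)) \<in> borel_measurable ?\<F>" if "j \<le> l" for j
    using measurable_compose[OF meas(1)[OF that] h] .
  have sets_s: "{\<omega> \<in> space ?\<F>. i \<in> s j \<omega>} \<in> sets ?\<F>" if "j < l" for j
  proof -
    have "{\<omega> \<in> space ?\<F>. i \<in> s j \<omega>} = s j -` {A \<in> Pow {1..n}. i \<in> A} \<inter> space ?\<F>"
      using measurable_space[OF s, of _ j] by auto
    also have "\<dots> \<in> sets ?\<F>"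
      by (rule measurable_sets[OF meas(3)[OF that]]) auto
    finally show ?thesis .
  qed
  have intercept: "(\<lambda>\<omega>. cut_intercept h (\<lambda>l. x l \<omega>) (\<lambda>l. \<epsilon> l \<omega>) (\<lambda>l. s l \<omega>) (\<lambda>l i. v l i \<omega>) i j)
      \<in> borel_measurable ?\<F>" if "j < l" for j
    using that
  proof (induction j)
    case 0
    then show ?case
      unfolding cut_intercept.simps
      by (intro borel_measurable_diff borel_measurable_inner hx meas i) auto
  next
    case (Suc j)
    then show ?case
      unfolding cut_intercept.simps
      by (intro measurable_If sets_s borel_measurable_diff borel_measurable_inner hx meas i) auto
  qed
  show ?thesis
    unfolding cut_gap_def using \<open>k < l\<close>
    by (intro borel_measurable_diff borel_measurable_add borel_measurable_inner hx meas i intercept) auto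
qed

section \<open>Convergence of inexact stochastic DCA\<close>

lemma isdca_run_path:
  assumes run: "isdca_run M n b G h x \<epsilon> s v" and "1 \<le> n" "1 \<le> b" "proper_fun G" "\<omega> \<in> space M"
  shows "isdca_path n G h (\<lambda>l. x l \<omega>) (\<lambda>l. \<epsilon> l \<omega>) (\<lambda>l. s l \<omega>) (\<lambda>l i. v l i \<omega>)"
proof
  have s: "s l \<in> M \<rightarrow>\<^sub>M count_space (Pow {1..n})" for l
    using run by (simp add: isdca_run_def)
  show "s l \<omega> \<subseteq> {1..n}" for l
    using measurable_space[OF s \<open>\<omega> \<in> space M\<close>] by simp
  have card: "\<forall>l>0. \<forall>\<omega>\<in>space M. card (s l \<omega>) = b"
    using run unfolding isdca_run_def by (elim conjE)
  show s0: "s 0 \<omega> = {1..n}"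
    using run \<open>\<omega> \<in> space M\<close> by (simp add: isdca_run_def)
  show "s l \<omega> \<noteq> {}" for l
  proof (cases l)
    case 0
    with s0 \<open>1 \<le> n\<close> show ?thesis by simp
  next
    case (Suc k)
    with card \<open>\<omega> \<in> space M\<close> have "card (s l \<omega>) = b" by simp
    with \<open>1 \<le> b\<close> show ?thesis by auto
  qed
  have "\<forall>l>0. \<forall>\<omega>\<in>space M. \<forall>i\<in>{1..n} - s l \<omega>. v l i \<omega> = v (l - 1) i \<omega>"
    using run unfolding isdca_run_def by (elim conjE)
  from this[rule_format, of "Suc _" \<omega>]
  show "v (Suc l) i \<omega> = v l i \<omega>" if "i \<in> {1..n} - s (Suc l) \<omega>" for i l
    using that \<open>\<omega> \<in> space M\<close> by simp
qed (use assms in \<open>simp_all add: isdca_run_def\<close>)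

text \<open>
  The gaps of component \<open>i\<close> are observed at the times when the drawn subset equals one fixed set \<open>A\<close>
  containing \<open>i\<close>. These are some of the times at which \<open>i\<close> is refreshed, so the observed gaps are
  summable on each trajectory.
\<close>
lemma isdca_gaps_summable:
  fixes x :: "nat \<Rightarrow> 'w \<Rightarrow> 'a::euclidean_space"
  assumes "prob_space M" "1 \<le> n" "b \<in> {1..n}" "proper_fun G"
    and convex: "\<And>i. i \<in> {1..n} \<Longrightarrow> convex_on UNIV (h i)"
    and lower: "\<And>y. ereal \<alpha> \<le> G y - ereal (1 / real n * (\<Sum>i=1..n. h i y))"
    and run: "isdca_run M n b G h x \<epsilon> s v"
    and tol: "AE \<omega> in M. summable (\<lambda>l. \<epsilon> l \<omega>)"
    and i: "i \<in> {1..n}"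
  shows "AE \<omega> in M. summable
    (cut_gap h (\<lambda>l. x l \<omega>) (\<lambda>l. \<epsilon> l \<omega>) (\<lambda>l. s l \<omega>) (\<lambda>l i. v l i \<omega>) i)"
proof -
  interpret prob_space M by fact
  have path: "isdca_path n G h (\<lambda>l. x l \<omega>) (\<lambda>l. \<epsilon> l \<omega>) (\<lambda>l. s l \<omega>) (\<lambda>l i. v l i \<omega>)"
    if "\<omega> \<in> space M" for \<omega>
    using isdca_run_path[OF run \<open>1 \<le> n\<close> _ \<open>proper_fun G\<close> that] \<open>b \<in> {1..n}\<close> by simp
  have s: "s l \<in> M \<rightarrow>\<^sub>M count_space (Pow {1..n})" for l
    using run by (simp add: isdca_run_def)
  have cont: "continuous_on UNIV (h i)"
    using convex[OF i] by (intro convex_on_continuous) auto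
  obtain A where A: "A \<subseteq> {1..n}" "card A = b" "i \<in> A"
  proof -
    have "b - 1 \<le> card ({1..n} - {i})"
      using \<open>b \<in> {1..n}\<close> i by (simp add: diff_le_mono)
    then obtain A' where "A' \<subseteq> {1..n} - {i}" "card A' = b - 1"
      by (rule obtain_subset_with_card_n)
    then have "insert i A' \<subseteq> {1..n}" "card (insert i A') = b"
      using i \<open>b \<in> {1..n}\<close> finite_subset[of A' "{1..n} - {i}"] by (auto simp: card_insert_if)
    with that show ?thesis by blast
  qed
  show ?thesis
  proof (rule AE_summable_of_sampled[where \<F> = "\<lambda>l. isdca_history M n x \<epsilon> s v (Suc l)"
        and B = "\<lambda>l. {\<omega> \<in> space M. s (Suc l) \<omega> = A}" and p = "1 / real (n choose b)"])
    show "subalgebra M (isdca_history M n x \<epsilon> s v (Suc l))" for l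
      using run by (rule subalgebra_isdca_history)
    show "(\<lambda>\<omega>. cut_gap h (\<lambda>l. x l \<omega>) (\<lambda>l. \<epsilon> l \<omega>) (\<lambda>l. s l \<omega>) (\<lambda>l i. v l i \<omega>) i k)
        \<in> borel_measurable (isdca_history M n x \<epsilon> s v (Suc l))" if "k \<le> l" for k l
      using that by (intro cut_gap_history_measurable[where s = s and h = h and i = i] s cont i) auto
    show "{\<omega> \<in> space M. s (Suc k) \<omega> = A} \<in> sets (isdca_history M n x \<epsilon> s v (Suc l))"
      if "k < l" for k l
    proof -
      have "{\<omega> \<in> space M. s (Suc k) \<omega> = A} =
          s (Suc k) -` {A} \<inter> space (isdca_history M n x \<epsilon> s v (Suc l))"
        by auto
      also have "\<dots> \<in> sets (isdca_history M n x \<epsilon> s v (Suc l))"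
        by (rule measurable_sets[OF isdca_history_measurable(3)[OF s]]) (use that A(1) in auto)
      finally show ?thesis .
    qed
    show "0 \<le> cut_gap h (\<lambda>l. x l \<omega>) (\<lambda>l. \<epsilon> l \<omega>) (\<lambda>l. s l \<omega>) (\<lambda>l i. v l i \<omega>) i l"
      if "\<omega> \<in> space M" for l \<omega>
      using isdca_path.gap_nonneg[OF path[OF that] i] .
    show "AE \<omega> in M. real_cond_exp M (isdca_history M n x \<epsilon> s v (Suc l))
        (indicator {\<omega> \<in> space M. s (Suc l) \<omega> = A}) \<omega> = 1 / real (n choose b)" for l
      using run A by (simp add: isdca_run_def cond_uniform_subset_def)
    show "0 < 1 / real (n choose b)"
      using \<open>b \<in> {1..n}\<close> by simp
    show "AE \<omega> in M. summable (\<lambda>l. indicator {\<omega> \<in> space M. s (Suc l) \<omega> = A} \<omega> *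
        cut_gap h (\<lambda>l. x l \<omega>) (\<lambda>l. \<epsilon> l \<omega>) (\<lambda>l. s l \<omega>) (\<lambda>l i. v l i \<omega>) i l)"
      using tol AE_space
    proof eventually_elim
      case (elim \<omega>)
      interpret isdca_path n G h "\<lambda>l. x l \<omega>" "\<lambda>l. \<epsilon> l \<omega>" "\<lambda>l. s l \<omega>" "\<lambda>l i. v l i \<omega>"
        using path elim by blast
      have "summable (\<lambda>l. if i \<in> s (Suc l) \<omega> then gap i l else 0)"
        using lower elim i by (intro sampled_gap_summable) (auto simp: H_def)
      then show ?case
        by (rule summable_comparison_test'[where N = 0])
           (use A(3) gap_nonneg[OF i] in \<open>auto simp: indicator_def\<close>)
    qed
  qed
qed

theorem theorem2:
  fixes M :: "'w measure"
    and n b :: nat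
    and g :: "nat \<Rightarrow> real ^ 'd \<Rightarrow> ereal"
    and h :: "nat \<Rightarrow> real ^ 'd \<Rightarrow> real"
    and F G :: "real ^ 'd \<Rightarrow> ereal"
    and H :: "real ^ 'd \<Rightarrow> real"
    and x :: "nat \<Rightarrow> 'w \<Rightarrow> real ^ 'd"
    and \<epsilon> :: "nat \<Rightarrow> 'w \<Rightarrow> real"
    and s :: "nat \<Rightarrow> 'w \<Rightarrow> nat set"
    and v :: "nat \<Rightarrow> nat \<Rightarrow> 'w \<Rightarrow> real ^ 'd"
  assumes "prob_space M"
    and "n \<ge> 1"
    and "b \<in> {1..n}"
    and "\<And>i. i \<in> {1..n} \<Longrightarrow> proper_fun (g i) \<and> lsc_fun (g i) \<and> ext_convex (g i)"
    and "\<And>i. i \<in> {1..n} \<Longrightarrow> convex_on UNIV (h i)"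
    and "\<And>y. G y = ereal (1 / real n) * (\<Sum>i=1..n. g i y)"
    and "\<And>y. H y = (1 / real n) * (\<Sum>i=1..n. h i y)"
    and "\<And>y. F y = ereal (1 / real n) * (\<Sum>i=1..n. g i y - ereal (h i y))"
    and "proper_fun G"
    and "(INF y. F y) > -\<infinity>"
    and "isdca_run M n b G h x \<epsilon> s v"
    and "AE \<omega> in M. summable (\<lambda>l. \<epsilon> l \<omega>)"
  shows "(AE \<omega> in M. \<exists>L::real. (\<lambda>l. F (x l \<omega>)) \<longlonglongrightarrow> ereal L) \<and>
    ((MIN i\<in>{1..n}. convexity_modulus (\<lambda>y. ereal (h i y))) > 0 \<longrightarrow>
      (AE \<omega> in M. summable (\<lambda>l. (norm (x (Suc l) \<omega> - x l \<omega>))\<^sup>2) \<and>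
                   (\<lambda>l. norm (x (Suc l) \<omega> - x l \<omega>)) \<longlonglongrightarrow> 0)) \<and>
    ((MIN i\<in>{1..n}. convexity_modulus (\<lambda>y. ereal (h i y))) > 0 \<longrightarrow>
      (AE \<omega> in M. \<forall>z. seq_limit_point (\<lambda>l. x l \<omega>) z \<longrightarrow> critical_point G H z))"
proof -
  have F_eq: "F y = G y - ereal (H y)" for y
    unfolding assms(6-8) using assms(2,4) by (intro mean_diff_ereal) (auto simp: proper_fun_def)
  obtain \<alpha> where "ereal \<alpha> < (INF y. F y)"
    using ereal_dense2[OF assms(10)] by blast
  then have lower: "ereal \<alpha> \<le> G y - ereal (H y)" for y
    unfolding F_eq[symmetric] by (meson INF_lower UNIV_I less_le_trans less_imp_le)
  have lsc: "G z \<le> liminf (\<lambda>j. G (u j))" if "u \<longlonglongrightarrow> z" for u z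
  proof -
    have "(\<Sum>i=1..n. g i z) \<le> liminf (\<lambda>j. \<Sum>i=1..n. g i (u j))"
      using assms(4) that by (intro sum_lsc_le_liminf) (auto simp: proper_fun_def)
    then show ?thesis
      unfolding assms(6)
      by (subst Liminf_ereal_mult_left) (auto intro!: ereal_mult_left_mono)
  qed
  have cont: "continuous_on UNIV (h i)" if "i \<in> {1..n}" for i
    using assms(5)[OF that] by (intro convex_on_continuous) auto
  have cont_H: "continuous_on UNIV H"
    unfolding assms(7) by (intro continuous_intros cont)
  have path: "isdca_path n G h (\<lambda>l. x l \<omega>) (\<lambda>l. \<epsilon> l \<omega>) (\<lambda>l. s l \<omega>) (\<lambda>l i. v l i \<omega>)"
    if "\<omega> \<in> space M" for \<omega>
    using isdca_run_path[OF assms(11,2) _ assms(9) that] assms(3) by simp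
  have "AE \<omega> in M. \<forall>i\<in>{1..n}. summable
      (cut_gap h (\<lambda>l. x l \<omega>) (\<lambda>l. \<epsilon> l \<omega>) (\<lambda>l. s l \<omega>) (\<lambda>l i. v l i \<omega>) i)"
    using assms(1-3,5,9,11,12) lower
    by (intro AE_finite_allI isdca_gaps_summable) (auto simp: assms(7))
  then have good: "AE \<omega> in M.
      isdca_path n G h (\<lambda>l. x l \<omega>) (\<lambda>l. \<epsilon> l \<omega>) (\<lambda>l. s l \<omega>) (\<lambda>l i. v l i \<omega>) \<and>
      summable (\<lambda>l. \<epsilon> l \<omega>) \<and>
      (\<forall>i\<in>{1..n}. summable
        (cut_gap h (\<lambda>l. x l \<omega>) (\<lambda>l. \<epsilon> l \<omega>) (\<lambda>l. s l \<omega>) (\<lambda>l i. v l i \<omega>) i))"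
    using assms(12) AE_space by eventually_elim (use path in blast)
  have H_path: "isdca_path.H n h = H"
    if "isdca_path n G h (\<lambda>l. x l \<omega>) (\<lambda>l. \<epsilon> l \<omega>) (\<lambda>l. s l \<omega>) (\<lambda>l i. v l i \<omega>)" for \<omega>
    by (rule ext) (simp add: isdca_path.H_def[OF that] assms(7))
  show ?thesis
  proof (intro conjI impI)
    show "AE \<omega> in M. \<exists>L::real. (\<lambda>l. F (x l \<omega>)) \<longlonglongrightarrow> ereal L"
      using good
    proof eventually_elim
      case (elim \<omega>)
      then show ?case
        using isdca_path.objective_convergent[of n G h "\<lambda>l. x l \<omega>" "\<lambda>l. \<epsilon> l \<omega>" "\<lambda>l. s l \<omega>" "\<lambda>l i. v l i \<omega>"]
          lower H_path[of \<omega>] by (auto simp: F_eq)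
    qed
  next
    assume strong: "(MIN i\<in>{1..n}. convexity_modulus (\<lambda>y. ereal (h i y))) > 0"
    show "AE \<omega> in M. summable (\<lambda>l. (norm (x (Suc l) \<omega> - x l \<omega>))\<^sup>2) \<and>
                   (\<lambda>l. norm (x (Suc l) \<omega> - x l \<omega>)) \<longlonglongrightarrow> 0"
      using good
    proof eventually_elim
      case (elim \<omega>)
      have summ: "summable (\<lambda>l. (norm (x (Suc l) \<omega> - x l \<omega>))\<^sup>2)"
        using strong elim assms(2) by (intro isdca_path.steps_square_summable) auto
      from tendsto_real_sqrt[OF summable_LIMSEQ_zero[OF this]] summ show ?case
        by simp
    qed
  next
    show "AE \<omega> in M. \<forall>z. seq_limit_point (\<lambda>l. x l \<omega>) z \<longrightarrow> critical_point G H z"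
      using good
    proof eventually_elim
      case (elim \<omega>)
      then show ?case
        using isdca_path.limit_point_critical[of n G h "\<lambda>l. x l \<omega>" "\<lambda>l. \<epsilon> l \<omega>" "\<lambda>l. s l \<omega>" "\<lambda>l i. v l i \<omega>"]
          lsc cont_H H_path[of \<omega>] by auto
    qed
  qed
qed

end
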